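(* Let $\mathcal X$ be a Polish space with its Borel $\sigma$-algebra, $\widehat{\mathbb P}$ a probability measure on $\mathcal X$, and $c:\mathcal X\times\mathcal X\to[0,\infty)$ continuous with $c(x,x)=0$ for all $x\in\mathcal X$. Let $f:\mathcal X\to\mathbb R$ be measurable with $\mathbb E_{\widehat{\mathbb P}}[f]>-\infty$. Then for every $\rho\ge0$ and $\lambda\ge0$, $$\overline{\mathcal L}(\rho)=\mathbb E_{\widehat X\sim\widehat{\mathbb P}}\Big[\sup_x\{f(x):c(\widehat X,x)\le\rho\}\Big],$$ $$(-\overline{\mathcal L})^*(-\lambda)=\sup_{\rho\ge0}\Big\{\mathbb E_{\widehat X\sim\widehat{\mathbb P}}\Big[\sup_x\{f(x):c(\widehat X,x)\le\rho\}\Big]-\lambda\rho\Big\}.$$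
   Context: $\mathcal P(\mathcal X)$ is the set of Borel probability measures on $\mathcal X$ and $\Gamma(\widehat{\mathbb P},\mathbb P)$ the set of probability measures on $\mathcal X\times\mathcal X$ with marginals $\widehat{\mathbb P}$ and $\mathbb P$. The maximum transport cost is $\overline{\mathcal K}_c(\widehat{\mathbb P},\mathbb P):=\inf_{\gamma\in\Gamma(\widehat{\mathbb P},\mathbb P)}\gamma\text{-}\operatorname{ess\,sup}_{\hat x,x\in\mathcal X}c(\hat x,x)$. The robust loss is $\overline{\mathcal L}(\rho):=\sup_{\mathbb P\in\mathcal P(\mathcal X)}\{\mathbb E_{X\sim\mathbb P}[f(X)]:\overline{\mathcal K}_c(\widehat{\mathbb P},\mathbb P)\le\rho\}$, and $(-\overline{\mathcal L})^*(-\lambda)=\sup_{\rho\ge0}\{\overline{\mathcal L}(\rho)-\lambda\rho\}$. Expectations may take values in $\overline{\mathbb R}$ (an integral is well defined when the positive or the negative part of the integrand has finite integral), and integrands that are only measurable with respect to the completion of the Borel $\sigma$-algebra under $\widehat{\mathbb P}$ are integrated against the completed measure. *)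

theory Defs
  imports "HOL-Probability.Probability"
begin

(* Integral of an extended real valued function: e2ennreal sends negative values to 0, so the two
   nonnegative integrals are those of the positive and of the negative part.  The value of
   ereal_expectation is meaningful only under ereal_expectation_exists. *)

definition ereal_expectation_exists :: "'a measure \<Rightarrow> ('a \<Rightarrow> ereal) \<Rightarrow> bool" where
  "ereal_expectation_exists M f \<longleftrightarrow>
     f \<in> borel_measurable M \<and>
     ((\<integral>\<^sup>+ x. e2ennreal (f x) \<partial>M) < \<infinity> \<or> (\<integral>\<^sup>+ x. e2ennreal (- f x) \<partial>M) < \<infinity>)"

definition ereal_expectation :: "'a measure \<Rightarrow> ('a \<Rightarrow> ereal) \<Rightarrow> ereal" where
  "ereal_expectation M f =
     enn2ereal (\<integral>\<^sup>+ x. e2ennreal (f x) \<partial>M) - enn2ereal (\<integral>\<^sup>+ x. e2ennreal (- f x) \<partial>M)"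

(* space (prob_algebra borel) is the set of Borel probability measures. *)

definition couplings :: "'a::polish_space measure \<Rightarrow> 'a measure \<Rightarrow> ('a \<times> 'a) measure set" where
  "couplings P Q =
     {\<gamma> \<in> space (prob_algebra borel). distr \<gamma> borel fst = P \<and> distr \<gamma> borel snd = Q}"

definition max_transport_cost ::
    "('a::polish_space \<Rightarrow> 'a \<Rightarrow> real) \<Rightarrow> 'a measure \<Rightarrow> 'a measure \<Rightarrow> ereal" where
  "max_transport_cost c P Q = (INF \<gamma>\<in>couplings P Q. esssup \<gamma> (\<lambda>(y, x). ereal (c y x)))"

(* The supremum ranges over those Q for which the expectation of f is well defined. *)

definition robust_loss ::
    "('a::polish_space \<Rightarrow> 'a \<Rightarrow> real) \<Rightarrow> 'a measure \<Rightarrow> ('a \<Rightarrow> real) \<Rightarrow> real \<Rightarrow> ereal" where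
  "robust_loss c P f \<rho> =
     Sup {ereal_expectation Q (\<lambda>x. ereal (f x)) | Q.
       Q \<in> space (prob_algebra borel) \<and>
       ereal_expectation_exists Q (\<lambda>x. ereal (f x)) \<and>
       max_transport_cost c P Q \<le> ereal \<rho>}"

(* Convex conjugate of a function on [0, \<infinity>). *)

definition conjugate_nonneg :: "(real \<Rightarrow> ereal) \<Rightarrow> real \<Rightarrow> ereal" where
  "conjugate_nonneg \<phi> s = (SUP \<rho>\<in>{0..}. ereal (s * \<rho>) - \<phi> \<rho>)"

lemma conjugate_nonneg_uminus:
  "conjugate_nonneg (\<lambda>\<rho>. - L \<rho>) (- l) = (SUP \<rho>\<in>{0..}. L \<rho> - ereal (l * \<rho>))"
  unfolding conjugate_nonneg_def by (simp add: minus_ereal_def add.commute)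

end

theory Submission
  imports Defs
begin

text \<open>
  Every Borel subset of a product of Polish spaces is the projection of a closed set in its product
  with the Baire space, so Choquet's capacity argument approximates its projection to the first
  coordinate by projections of compact families, over which there are Borel selectors. This yields a
  Borel map \<open>T\<close> with \<open>(y, T y) \<in> B\<close> for almost every \<open>y\<close> in the projection of \<open>B\<close>. Applied to
  \<open>{c y x \<le> \<rho> \<and> q < f x}\<close> for all rational \<open>q\<close> and pasted together, such selectors give Borel maps
  \<open>T n\<close> with \<open>c y (T n y) \<le> \<rho>\<close> along which \<open>f\<close> increases almost surely to the supremum. Their
  image measures give the lower bound.

  For the upper bound let \<open>K\<close> be a compact subset of \<open>{f \<ge> s}\<close>. A coupling of cost below
  \<open>\<rho> + 1 / n\<close> shows that \<open>Q K\<close> is at most the \<open>P\<close>-measure of the points within cost \<open>\<rho> + 1 / n\<close> of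
  \<open>K\<close>, and by compactness this also holds for \<open>n = \<infinity>\<close>. So \<open>f\<close> under \<open>Q\<close> is stochastically dominated
  by the supremum under \<open>P\<close>; no optimal coupling is needed.
\<close>

section \<open>Borel sets as projections of closed sets\<close>

text \<open>\<open>nat discrete\<close> instead of \<open>nat\<close>, because \<open>nat\<close> is not an instance of \<open>complete_space\<close>.\<close>

definition suslin :: "'a::topological_space set \<Rightarrow> bool" where
  "suslin A \<longleftrightarrow> (\<exists>F::('a \<times> (nat \<Rightarrow> nat discrete)) set. closed F \<and> A = fst ` F)"

lemma suslin_closed: "closed A \<Longrightarrow> suslin A"
  unfolding suslin_def by (rule exI[of _ "A \<times> UNIV"]) (auto intro: closed_Times)

text \<open>In a point of \<open>G\<close> the coordinate \<open>0\<close> of the Baire point names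
  an index \<open>n\<close>, and the shifted remainder witnesses membership in
  \<open>A n\<close>.\<close>

lemma suslin_UN:
  fixes A :: "nat \<Rightarrow> 'a::topological_space set"
  assumes "\<And>n. suslin (A n)"
  shows "suslin (\<Union>n. A n)"
proof -
  from assms obtain F :: "nat \<Rightarrow> ('a \<times> (nat \<Rightarrow> nat discrete)) set"
    where F: "\<And>n. closed (F n)" "\<And>n. A n = fst ` F n"
    unfolding suslin_def by metis
  define G where "G = {p :: 'a \<times> (nat \<Rightarrow> nat discrete).
      \<forall>n. snd p 0 = discrete n \<longrightarrow> (fst p, \<lambda>k. snd p (Suc k)) \<in> F n}"
  have "closed {p :: 'a \<times> (nat \<Rightarrow> nat discrete). snd p 0 = d \<longrightarrow> (fst p, \<lambda>k. snd p (Suc k)) \<in> F n}" for n d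
  proof -
    \<comment> \<open>The implication describes a union of two closed sets: singletons are open in
      the discrete space, so the set where its premise fails is closed as well.\<close>
    have 1: "closed ((\<lambda>p :: 'a \<times> (nat \<Rightarrow> nat discrete). (fst p, \<lambda>k. snd p (Suc k))) -` F n)"
      by (intro closed_vimage F continuous_intros continuous_on_coordinatewise_then_product
          continuous_on_compose2[OF continuous_on_product_coordinates]) auto
    have 2: "closed ((\<lambda>p :: 'a \<times> (nat \<Rightarrow> nat discrete). snd p 0) -` (-{d}))"
      by (intro closed_vimage continuous_intros
          continuous_on_compose2[OF continuous_on_product_coordinates]) (auto simp: closed_def open_discrete)
    show ?thesis
      using closed_Un[OF 1 2] by (rule arg_cong[THEN iffD1, rotated]) auto
  qed
  then have "closed G" unfolding G_def by (intro closed_Collect_all) auto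
  moreover have "(\<Union>n. A n) = fst ` G"
  proof (intro set_eqI iffI)
    fix x assume "x \<in> (\<Union>n. A n)"
    then obtain n z where "(x, z) \<in> F n" using F(2) by force
    then have "(x, case_nat (discrete n) z) \<in> G"
      by (auto simp: G_def discrete_inject)
    then show "x \<in> fst ` G" by force
  next
    fix x assume "x \<in> fst ` G"
    then obtain z where z: "(x, z) \<in> G" by auto
    obtain n where "z 0 = discrete n" by (metis of_discrete_inverse)
    with z have "(x, \<lambda>k. z (Suc k)) \<in> F n" by (auto simp: G_def)
    then show "x \<in> (\<Union>n. A n)" using F(2) by force
  qed
  ultimately show ?thesis unfolding suslin_def by blast
qed

text \<open>One Baire point codes a whole sequence of Baire points through
  \<open>prod_encode\<close>, so the witnesses for all \<open>A n\<close> fit into a single one, and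
  the conditions on them intersect to a closed condition.\<close>

lemma suslin_INT:
  fixes A :: "nat \<Rightarrow> 'a::topological_space set"
  assumes "\<And>n. suslin (A n)"
  shows "suslin (\<Inter>n. A n)"
proof -
  from assms obtain F :: "nat \<Rightarrow> ('a \<times> (nat \<Rightarrow> nat discrete)) set"
    where F: "\<And>n. closed (F n)" "\<And>n. A n = fst ` F n"
    unfolding suslin_def by metis
  define G where "G = {p :: 'a \<times> (nat \<Rightarrow> nat discrete).
      \<forall>n. (fst p, \<lambda>k. snd p (prod_encode (n, k))) \<in> F n}"
  have "closed ((\<lambda>p :: 'a \<times> (nat \<Rightarrow> nat discrete). (fst p, \<lambda>k. snd p (prod_encode (n, k)))) -` F n)" for n
    by (intro closed_vimage F continuous_intros continuous_on_coordinatewise_then_product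
          continuous_on_compose2[OF continuous_on_product_coordinates]) auto
  then have "closed G" unfolding G_def by (intro closed_Collect_all) (auto simp: vimage_def)
  moreover have "(\<Inter>n. A n) = fst ` G"
  proof (intro set_eqI iffI)
    fix x assume "x \<in> (\<Inter>n. A n)"
    then have "\<forall>n. \<exists>z. (x, z) \<in> F n" using F(2) by force
    then obtain z where "\<And>n. (x, z n) \<in> F n" by metis
    then have "(x, \<lambda>j. case prod_decode j of (n, k) \<Rightarrow> z n k) \<in> G"
      by (auto simp: G_def)
    then show "x \<in> fst ` G" by force
  next
    fix x assume "x \<in> fst ` G"
    then show "x \<in> (\<Inter>n. A n)" using F(2) by (force simp: G_def)
  qed
  ultimately show ?thesis unfolding suslin_def by blast
qed

lemma suslin_open:
  fixes A :: "'a::metric_space set"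
  assumes "open A"
  shows "suslin A"
proof -
  have "fsigma_in euclidean A"
    using assms by (intro open_imp_fsigma_in metrizable_space_euclidean) simp
  then obtain C :: "nat \<Rightarrow> 'a set" where "\<And>n. closed (C n)" "A = (\<Union>n. C n)"
    unfolding fsigma_in_ascending by auto
  then show ?thesis by (simp add: suslin_UN suslin_closed)
qed

text \<open>Complements of Suslin sets need not be Suslin, so the induction carries the claim for a
  set and for its complement together. Countable unions then use \<open>suslin_UN\<close> for the
  set and \<open>suslin_INT\<close> for the complement.\<close>

lemma borel_imp_suslin:
  fixes A :: "'a::metric_space set"
  assumes "A \<in> sets borel"
  shows "suslin A"
proof -
  have "A \<in> sigma_sets UNIV (Collect closed)" using assms by (simp add: borel_eq_closed)
  then have "suslin A \<and> suslin (- A)"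
  proof induction
    case (Basic a)
    then show ?case by (auto intro: suslin_closed suslin_open)
  next
    case Empty
    show ?case by (auto intro: suslin_closed)
  next
    case (Compl a)
    then show ?case by (simp add: Compl_eq_Diff_UNIV[symmetric])
  next
    case (Union a)
    then show ?case by (auto intro: suslin_UN suslin_INT)
  qed
  then show ?thesis ..
qed

section \<open>Measurable selection\<close>

text \<open>Adding the finitely many terms outside the covered tail to the centres makes the closure
  of the range totally bounded, hence compact. This serves sequences that only approach a compact
  set without lying in it.\<close>

lemma totally_bounded_sequence_convergent_subseq:
  fixes w :: "nat \<Rightarrow> 'w::complete_space"
  assumes "\<And>e. e > 0 \<Longrightarrow> \<exists>T. finite T \<and> (\<forall>\<^sub>F n in sequentially. w n \<in> (\<Union>x\<in>T. cball x e))"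
  shows "\<exists>l r. strict_mono r \<and> (w \<circ> r) \<longlonglongrightarrow> l"
proof -
  have "compact (closure (range w))"
    unfolding compact_eq_totally_bounded
  proof (intro conjI allI impI)
    show "Topological_Spaces.complete (closure (range w))" by (simp add: complete_eq_closed)
    fix e :: real assume e: "e > 0"
    then obtain T where T: "finite T" "\<forall>\<^sub>F n in sequentially. w n \<in> (\<Union>x\<in>T. cball x (e/2))"
      using assms[of "e/2"] by auto
    then obtain m where m: "\<And>n. n \<ge> m \<Longrightarrow> w n \<in> (\<Union>x\<in>T. cball x (e/2))"
      by (auto simp: eventually_sequentially)
    let ?T = "T \<union> w ` {..<m}"
    have "w n \<in> (\<Union>x\<in>?T. cball x (e/2))" for n
    proof (cases "n < m")
      case True
      then show ?thesis using e by (intro UN_I[of "w n"]) auto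
    next
      case False
      then show ?thesis using m[of n] by auto
    qed
    then have "range w \<subseteq> (\<Union>x\<in>?T. cball x (e/2))" by blast
    moreover have "closed (\<Union>x\<in>?T. cball x (e/2))" using T(1) by (intro closed_UN) auto
    ultimately have "closure (range w) \<subseteq> (\<Union>x\<in>?T. cball x (e/2))" by (rule closure_minimal)
    also have "\<dots> \<subseteq> (\<Union>x\<in>?T. ball x e)" using e by (intro UN_mono) auto
    finally show "\<exists>k. finite k \<and> closure (range w) \<subseteq> (\<Union>x\<in>k. ball x e)"
      using T(1) by (intro exI[of _ ?T]) auto
  qed
  then have "seq_compact (closure (range w))" by (simp add: compact_eq_seq_compact_metric)
  then have "(\<forall>n. w n \<in> closure (range w)) \<longrightarrow>
      (\<exists>l\<in>closure (range w). \<exists>r. strict_mono r \<and> (w \<circ> r) \<longlonglongrightarrow> l)"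
    unfolding seq_compact_def by (rule spec)
  then show ?thesis by (auto simp: closure_subset[THEN subsetD])
qed

text \<open>Along a convergent sequence of base points the witnesses in \<open>C\<close> have a
  convergent subsequence, whose limit is a witness for the limit point.\<close>

lemma closed_projection_compact:
  fixes F :: "('y::metric_space \<times> 'w::metric_space) set"
  assumes "closed F" "compact C"
  shows "closed {y. \<exists>w\<in>C. (y, w) \<in> F}"
  unfolding closed_sequential_limits
proof safe
  fix y l assume y: "\<forall>n. y n \<in> {y. \<exists>w\<in>C. (y, w) \<in> F}" and l: "y \<longlonglongrightarrow> l"
  then have "\<forall>n. \<exists>v. v \<in> C \<and> (y n, v) \<in> F" by blast
  then obtain w where w: "\<And>n. w n \<in> C" "\<And>n. (y n, w n) \<in> F" by metis
  obtain v r where v: "v \<in> C" "strict_mono (r :: nat \<Rightarrow> nat)" "(w \<circ> r) \<longlonglongrightarrow> v"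
    using assms(2) w(1) by (auto simp: compact_eq_seq_compact_metric elim: seq_compactE[where f=w])
  have "(\<lambda>n. ((y \<circ> r) n, (w \<circ> r) n)) \<longlonglongrightarrow> (l, v)"
    by (intro tendsto_Pair LIMSEQ_subseq_LIMSEQ[OF l] v)
  then have "(l, v) \<in> F"
    by (rule closed_sequentially[OF assms(1), rotated]) (simp add: w(2))
  with v show "\<exists>w\<in>C. (l, w) \<in> F" by blast
qed

section \<open>Choquet's capacity argument and selection over compact sets\<close>

lemma dense_sequence:
  obtains q :: "nat \<Rightarrow> 'w::{metric_space, second_countable_topology}"
  where "\<And>x e. e > 0 \<Longrightarrow> \<exists>i. dist (q i) x < e"
proof -
  obtain D :: "'w set" where D: "countable D" "\<And>X. open X \<Longrightarrow> X \<noteq> {} \<Longrightarrow> \<exists>d \<in> D. d \<in> X"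
    by (rule countable_dense_setE) blast
  have "D \<noteq> {}" using D(2)[of UNIV] by auto
  show thesis
  proof
    fix x :: 'w and e :: real assume "e > 0"
    then obtain d where "d \<in> D" "d \<in> ball x e" using D(2)[of "ball x e"] by auto
    moreover obtain i where "d = from_nat_into D i"
      using \<open>d \<in> D\<close> D(1) by (metis from_nat_into_surj)
    ultimately show "\<exists>i. dist (from_nat_into D i) x < e" by (auto simp: dist_commute)
  qed
qed

text \<open>The fibre variable is confined, for each \<open>n\<close> in turn, to finitely many
  balls of radius \<open>(1/2)^n\<close>, each time keeping the outer measure of the projection
  above \<open>e\<close>. The surviving fibre points form the compact set \<open>C\<close>.\<close>

lemma closed_projection_inner_compact:
  fixes F :: "('y::metric_space \<times> 'w::{complete_space, second_countable_topology}) set"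
  assumes F: "closed F" and P: "finite_measure P" "sets P = sets borel"
    and e: "e < outer_measure_of P (fst ` F)"
  shows "\<exists>C. compact C \<and> e \<le> emeasure P {y. \<exists>w\<in>C. (y, w) \<in> F}"
proof -
  interpret finite_measure P by fact
  have [simp]: "space P = UNIV" using sets_eq_imp_space_eq[OF P(2)] by simp
  obtain q :: "nat \<Rightarrow> 'w" where q: "\<And>x e. e > 0 \<Longrightarrow> \<exists>i. dist (q i) x < e"
    by (rule dense_sequence) blast
  define U where "U n k = (\<Union>i\<le>k. cball (q i) ((1/2)^n))" for n k :: nat
  have U_cov: "(\<Union>k. U n k) = UNIV" for n
  proof -
    have "\<exists>i. dist (q i) x < (1/2)^n" for x by (rule q) simp
    then have "\<exists>k. x \<in> U n k" for x unfolding U_def by (metis UN_I atMost_iff less_imp_le mem_cball order_refl)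
    then show ?thesis by blast
  qed
  have U_closed: "closed (U n k)" for n k unfolding U_def by (intro closed_UN) auto
  have U_mono: "U n k \<subseteq> U n k'" if "k \<le> k'" for n k k'
    using that unfolding U_def by (intro UN_mono) auto
  \<comment> \<open>Outer measure is continuous along increasing sequences of arbitrary sets, so the
    projections need not be measurable here.\<close>
  have step: "\<exists>k. e < outer_measure_of P (fst ` (G \<inter> UNIV \<times> U n k))"
    if "e < outer_measure_of P (fst ` G)" for G n
  proof -
    have "(SUP k. outer_measure_of P (fst ` (G \<inter> UNIV \<times> U n k))) = outer_measure_of P (\<Union>k. fst ` (G \<inter> UNIV \<times> U n k))"
    proof (rule SUP_outer_measure_of_incseq)
      show "incseq (\<lambda>k. fst ` (G \<inter> UNIV \<times> U n k))"
        by (intro incseq_SucI image_mono Int_mono Sigma_mono subset_refl U_mono) simp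
    qed simp
    also have "(\<Union>k. fst ` (G \<inter> UNIV \<times> U n k)) = fst ` (G \<inter> UNIV \<times> (\<Union>k. U n k))" by auto
    also have "\<dots> = fst ` G" unfolding U_cov by auto
    finally show ?thesis using that by (metis (no_types, lifting) less_SUP_iff)
  qed
  have "\<exists>G. \<forall>n. (e < outer_measure_of P (fst ` G n) \<and> (n = 0 \<longrightarrow> G n = F)) \<and>
      (\<exists>k. G (Suc n) = G n \<inter> UNIV \<times> U n k)"
  proof (rule dependent_nat_choice)
    show "\<exists>G. e < outer_measure_of P (fst ` G) \<and> ((0::nat) = 0 \<longrightarrow> G = F)" using e by blast
    fix G and n :: nat assume "e < outer_measure_of P (fst ` G) \<and> (n = 0 \<longrightarrow> G = F)"
    then obtain k where "e < outer_measure_of P (fst ` (G \<inter> UNIV \<times> U n k))" using step by blast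
    then show "\<exists>G'. (e < outer_measure_of P (fst ` G') \<and> (Suc n = 0 \<longrightarrow> G' = F)) \<and>
        (\<exists>k. G' = G \<inter> UNIV \<times> U n k)" by blast
  qed
  then obtain G where "\<And>n. e < outer_measure_of P (fst ` G n)" "G 0 = F"
    "\<And>n. \<exists>k. G (Suc n) = G n \<inter> UNIV \<times> U n k" by blast
  then obtain k where G: "\<And>n. e < outer_measure_of P (fst ` G n)" "G 0 = F"
    "\<And>n. G (Suc n) = G n \<inter> UNIV \<times> U n (k n)" by metis
  have G_eq: "G n = F \<inter> UNIV \<times> (\<Inter>m<n. U m (k m))" for n
    by (induction n) (auto simp: G less_Suc_eq)
  define C where "C = (\<Inter>m. U m (k m))"
  have half: "\<exists>m. (1/2)^m < d" if "d > 0" for d :: real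
    using that by (intro real_arch_pow_inv) auto
  have C: "compact C"
    unfolding compact_eq_totally_bounded
  proof (intro conjI allI impI)
    show "Topological_Spaces.complete C" unfolding C_def complete_eq_closed by (intro closed_INT ballI U_closed)
    fix d :: real assume "d > 0"
    then obtain m where m: "(1/2)^m < d" using half by blast
    have "C \<subseteq> U m (k m)" by (auto simp: C_def)
    also have "\<dots> \<subseteq> (\<Union>x\<in>q ` {..k m}. ball x d)" using m by (force simp: U_def)
    finally show "\<exists>k. finite k \<and> C \<subseteq> (\<Union>x\<in>k. ball x d)" by blast
  qed
  \<comment> \<open>A point \<open>y\<close> of all the closures is a limit of base points of
    \<open>p n\<close> in \<open>G n\<close>. The fibre points of \<open>p n\<close> satisfy more
    and more of the ball constraints, so a subsequence converges to a point of \<open>C\<close>, and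
    closedness of \<open>F\<close> puts the limit pair into \<open>F\<close>.\<close>
  have "(\<Inter>n. closure (fst ` G n)) \<subseteq> {y. \<exists>w\<in>C. (y, w) \<in> F}"
  proof
    fix y assume y: "y \<in> (\<Inter>n. closure (fst ` G n))"
    have "\<exists>p. p \<in> G n \<and> dist (fst p) y < inverse (real (Suc n))" for n
      using y by (auto simp: closure_approachable dest!: spec[of _ n] spec[of _ "inverse (real (Suc n))"])
    then obtain p where p: "\<And>n. p n \<in> G n" "\<And>n. dist (fst (p n)) y < inverse (real (Suc n))"
      by metis
    have lim_y: "(\<lambda>n. fst (p n)) \<longlonglongrightarrow> y"
      by (rule Lim_null_comparison[THEN tendsto_dist_iff[THEN iffD2], OF _ LIMSEQ_inverse_real_of_nat])
         (use p(2) in \<open>auto intro!: always_eventually less_imp_le\<close>)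
    have pU: "snd (p n) \<in> U m (k m)" if "m < n" for m n
      using p(1)[of n] that by (auto simp: G_eq)
    have "\<exists>v r. strict_mono r \<and> ((\<lambda>n. snd (p n)) \<circ> r) \<longlonglongrightarrow> v"
    proof (rule totally_bounded_sequence_convergent_subseq)
      fix d :: real assume "d > 0"
      then obtain m where m: "(1/2)^m < d" using half by blast
      have "\<forall>\<^sub>F n in sequentially. snd (p n) \<in> (\<Union>x\<in>q ` {..k m}. cball x d)"
        using eventually_gt_at_top[of m]
      proof eventually_elim
        case (elim n)
        then have "snd (p n) \<in> U m (k m)" by (rule pU)
        also have "\<dots> \<subseteq> (\<Union>x\<in>q ` {..k m}. cball x d)" using m by (force simp: U_def)
        finally show ?case .
      qed
      then show "\<exists>T. finite T \<and> (\<forall>\<^sub>F n in sequentially. snd (p n) \<in> (\<Union>x\<in>T. cball x d))" by blast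
    qed
    then obtain v and r :: "nat \<Rightarrow> nat" where r: "strict_mono r" "((\<lambda>n. snd (p n)) \<circ> r) \<longlonglongrightarrow> v" by blast
    have "v \<in> U m (k m)" for m
    proof (rule Lim_in_closed_set[OF U_closed _ _ r(2)])
      show "\<forall>\<^sub>F n in sequentially. ((\<lambda>n. snd (p n)) \<circ> r) n \<in> U m (k m)"
        using eventually_gt_at_top[of m]
        by eventually_elim (simp add: pU order_less_le_trans[OF _ seq_suble[OF r(1)]])
    qed simp
    then have "v \<in> C" by (simp add: C_def)
    moreover have "(\<lambda>n. (((\<lambda>n. fst (p n)) \<circ> r) n, ((\<lambda>n. snd (p n)) \<circ> r) n)) \<longlonglongrightarrow> (y, v)"
      by (intro tendsto_Pair LIMSEQ_subseq_LIMSEQ[OF lim_y] r)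
    then have "(y, v) \<in> F"
      by (rule closed_sequentially[OF F, rotated]) (use p(1) in \<open>auto simp: G_eq\<close>)
    ultimately show "y \<in> {y. \<exists>w\<in>C. (y, w) \<in> F}" by blast
  qed
  \<comment> \<open>Closures replace the projections because they are measurable; finiteness of
    \<open>P\<close> then gives continuity from above. The strict bound becomes weak in the
    limit.\<close>
  moreover have "e \<le> emeasure P (\<Inter>n. closure (fst ` G n))"
  proof -
    have "e \<le> emeasure P (closure (fst ` G n))" for n
    proof -
      have "e \<le> outer_measure_of P (closure (fst ` G n))"
        using G(1)[of n] outer_measure_of_mono[OF closure_subset, of P "fst ` G n"] by (auto dest: less_le_trans)
      then show ?thesis by (simp add: P(2))
    qed
    then have "e \<le> (INF n. emeasure P (closure (fst ` G n)))" by (rule INF_greatest)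
    also have "\<dots> = emeasure P (\<Inter>n. closure (fst ` G n))"
      by (intro INF_emeasure_decseq) (auto simp: P(2) decseq_Suc_iff G(3) intro!: closure_mono image_mono)
    finally show ?thesis .
  qed
  moreover have "{y. \<exists>w\<in>C. (y, w) \<in> F} \<in> sets P"
    using closed_projection_compact[OF F C] by (simp add: P(2))
  ultimately have "e \<le> emeasure P {y. \<exists>w\<in>C. (y, w) \<in> F}"
    by (blast intro: order_trans emeasure_mono)
  with C show ?thesis by blast
qed

text \<open>The selector is found by successive approximation: at stage \<open>n\<close> the least
  index \<open>d y n\<close> is taken for which the section over \<open>C\<close> still has a point
  close to all centres chosen so far. Least indices of measurable conditions are measurable, and the
  centres converge to a point of the section.\<close>

lemma compact_section_selector:
  fixes F :: "('y::metric_space \<times> 'w::{complete_space, second_countable_topology}) set"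
  assumes F: "closed F" and C: "compact C"
  shows "\<exists>s\<in>borel_measurable borel. \<forall>y. (\<exists>w\<in>C. (y, w) \<in> F) \<longrightarrow> (y, s y) \<in> F"
proof -
  obtain q :: "nat \<Rightarrow> 'w" where q: "\<And>x e. e > 0 \<Longrightarrow> \<exists>i. dist (q i) x < e"
    by (rule dense_sequence) blast
  \<comment> \<open>Weak inequalities keep the constraint closed, so that
    \<open>closed_projection_compact\<close> applies; \<open>S y []\<close> only says that the
    section over \<open>C\<close> is nonempty.\<close>
  define S where "S y l \<longleftrightarrow> (\<exists>w\<in>C. (y, w) \<in> F \<and> (\<forall>k<length l. dist w (q (l ! k)) \<le> (1/2)^k))" for y l
  have "closed {y. S y l}" for l
  proof -
    have "closed (F \<inter> {p. \<forall>k<length l. dist (snd p) (q (l ! k)) \<le> (1/2)^k})"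
      by (intro closed_Int F closed_Collect_all closed_Collect_imp closed_Collect_le continuous_intros) auto
    from closed_projection_compact[OF this C] show ?thesis by (simp add: S_def)
  qed
  then have S_meas [measurable]: "Measurable.pred borel (\<lambda>y. S y l)" for l
    by (simp add: pred_def borel_closed)
  have S_ext: "\<exists>i. S y (l @ [i])" if "S y l" for y l
  proof -
    from that obtain w where w: "w \<in> C" "(y, w) \<in> F" "\<forall>k<length l. dist w (q (l ! k)) \<le> (1/2)^k"
      by (auto simp: S_def)
    obtain i where "dist (q i) w < (1/2)^length l" using q[of "(1/2)^length l" w] by auto
    with w have "S y (l @ [i])"
      unfolding S_def by (intro bexI[of _ w]) (auto simp: nth_append less_Suc_eq dist_commute)
    then show ?thesis ..
  qed
  define pre where "pre y = rec_nat [] (\<lambda>_ l. l @ [LEAST i. S y (l @ [i])])" for y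
  define d where "d y n = (LEAST i. S y (pre y n @ [i]))" for y n
  have pre_simps: "pre y 0 = []" "pre y (Suc n) = pre y n @ [d y n]" for y n
    by (simp_all add: pre_def d_def)
  have pre_nth: "length (pre y n) = n \<and> (\<forall>k<n. pre y n ! k = d y k)" for y n
    by (induction n) (auto simp: pre_simps nth_append less_Suc_eq)
  have S_pre: "S y (pre y n)" if "S y []" for y n
  proof (induction n)
    case (Suc n)
    from LeastI_ex[OF S_ext[OF this]] show ?case by (simp add: pre_simps d_def)
  qed (simp add: that pre_simps)
  \<comment> \<open>One induction proves both claims, since \<open>d y n\<close> depends on
    \<open>pre y n\<close> and \<open>pre y (Suc n)\<close> on both. Lists over \<open>nat\<close>
    are countable, so a measurable prefix may be substituted into \<open>S\<close>.\<close>
  have pre_meas: "(\<lambda>y. pre y n) \<in> borel \<rightarrow>\<^sub>M count_space UNIV"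
    and d_meas: "(\<lambda>y. d y n) \<in> borel \<rightarrow>\<^sub>M count_space UNIV" for n
  proof (induction n)
    case 0
    { case 1 show ?case by (simp add: pre_simps) }
    { case 2 show ?case by (simp add: d_def pre_simps) }
  next
    case (Suc n)
    have "(\<lambda>y. l @ [d y n]) \<in> borel \<rightarrow>\<^sub>M count_space UNIV" for l
      by (rule measurable_compose[OF Suc(2)]) simp
    then have *: "(\<lambda>y. pre y (Suc n)) \<in> borel \<rightarrow>\<^sub>M count_space UNIV"
      unfolding pre_simps
      by (rule measurable_compose_countable[where f = "\<lambda>l y. l @ [d y n]", OF _ Suc(1)])
    { case 1 show ?case by (rule *) }
    { case 2
      have "Measurable.pred borel (\<lambda>y. S y (pre y (Suc n) @ [i]))" for i
        by (rule measurable_compose_countable[where f = "\<lambda>l y. S y (l @ [i])", OF S_meas *])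
      then show ?case unfolding d_def by (rule measurable_Least) }
  qed
  \<comment> \<open>Each finite prefix has its own witness in \<open>C\<close>; compactness supplies
    one point that meets all constraints at once.\<close>
  have ex_lim: "\<exists>w. (y, w) \<in> F \<and> (\<forall>k. dist w (q (d y k)) \<le> (1/2)^k)" if "S y []" for y
  proof -
    have "\<exists>w. w \<in> C \<and> (y, w) \<in> F \<and> (\<forall>k<n. dist w (q (d y k)) \<le> (1/2)^k)" for n
      using S_pre[OF that, of n] pre_nth[of y n] by (auto simp: S_def)
    then obtain w where w: "\<And>n. w n \<in> C" "\<And>n. (y, w n) \<in> F"
      "\<And>n k. k < n \<Longrightarrow> dist (w n) (q (d y k)) \<le> (1/2)^k" by metis
    obtain v and r :: "nat \<Rightarrow> nat" where v: "v \<in> C" "strict_mono r" "(w \<circ> r) \<longlonglongrightarrow> v"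
      using C w(1) by (auto simp: compact_eq_seq_compact_metric elim: seq_compactE[where f=w])
    have "(y, v) \<in> F"
    proof (rule closed_sequentially[OF F])
      show "(\<lambda>n. (y, (w \<circ> r) n)) \<longlonglongrightarrow> (y, v)" by (intro tendsto_intros v)
    qed (simp add: w(2))
    moreover have "dist v (q (d y k)) \<le> (1/2)^k" for k
    proof (rule tendsto_upperbound)
      show "(\<lambda>n. dist ((w \<circ> r) n) (q (d y k))) \<longlonglongrightarrow> dist v (q (d y k))" by (intro tendsto_intros v)
      show "\<forall>\<^sub>F n in sequentially. dist ((w \<circ> r) n) (q (d y k)) \<le> (1/2)^k"
        using eventually_gt_at_top[of k]
        by eventually_elim (use w(3) order_less_le_trans[OF _ seq_suble[OF v(2)]] in auto)
    qed simp
    ultimately show ?thesis by blast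
  qed
  then obtain t where t: "\<And>y. S y [] \<Longrightarrow> (y, t y) \<in> F" "\<And>y k. S y [] \<Longrightarrow> dist (t y) (q (d y k)) \<le> (1/2)^k"
    by metis
  \<comment> \<open>\<open>t\<close> comes from choice; measurability is recovered by writing
    \<open>s\<close> as the pointwise limit of the centres \<open>q (d y n)\<close>, with the
    constant \<open>q 0\<close> where the section over \<open>C\<close> is empty.\<close>
  define s where "s y = (if S y [] then t y else q 0)" for y
  have "s \<in> borel_measurable borel"
  proof (rule borel_measurable_LIMSEQ_metric)
    have "(\<lambda>y. q (d y n)) \<in> borel_measurable borel" for n
      by (rule measurable_compose[OF d_meas]) simp
    then show "(\<lambda>y. if S y [] then q (d y n) else q 0) \<in> borel_measurable borel" for n
      by measurable
    fix y
    have "(\<lambda>n. q (d y n)) \<longlonglongrightarrow> t y" if "S y []"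
    proof (rule tendsto_dist_iff[THEN iffD2, OF Lim_null_comparison])
      show "(\<lambda>n. (1/2)^n) \<longlonglongrightarrow> (0::real)" by (intro LIMSEQ_power_zero) simp
      show "\<forall>\<^sub>F n in sequentially. norm (dist (q (d y n)) (t y)) \<le> (1/2)^n"
        using t(2)[OF that] by (auto simp: dist_commute)
    qed
    then show "(\<lambda>n. if S y [] then q (d y n) else q 0) \<longlonglongrightarrow> s y" by (simp add: s_def)
  qed
  moreover have "S y [] \<longleftrightarrow> (\<exists>w\<in>C. (y, w) \<in> F)" for y by (simp add: S_def)
  ultimately show ?thesis using t(1) by (intro bexI[of _ s]) (auto simp: s_def)
qed

text \<open>Compact families \<open>C n\<close> exhaust the outer measure of the projection of
  \<open>B\<close> up to \<open>1 / (n + 1)\<close>, so their projections \<open>D n\<close> cover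
  almost all of a measurable hull. The selectors over the \<open>C n\<close> are then pasted
  together.\<close>

theorem measurable_selection_AE:
  fixes B :: "('y::metric_space \<times> 'x::{complete_space, second_countable_topology}) set"
  assumes P: "finite_measure P" "sets P = sets borel" and B: "B \<in> sets borel"
  shows "\<exists>T\<in>borel_measurable borel. AE y in P. (\<exists>x. (y, x) \<in> B) \<longrightarrow> (y, T y) \<in> B"
proof -
  interpret finite_measure P by fact
  have [simp]: "space P = UNIV" using sets_eq_imp_space_eq[OF P(2)] by simp
  obtain F :: "(('y \<times> 'x) \<times> (nat \<Rightarrow> nat discrete)) set" where F: "closed F" "B = fst ` F"
    using borel_imp_suslin[OF B] by (auto simp: suslin_def)
  \<comment> \<open>Reassociation merges the second coordinate of \<open>B\<close> with the Baire
    coordinate, so that both are selected together over \<open>y\<close>.\<close>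
  define F' where "F' = {p :: 'y \<times> 'x \<times> (nat \<Rightarrow> nat discrete). ((fst p, fst (snd p)), snd (snd p)) \<in> F}"
  have F': "closed F'"
    unfolding F'_def by (intro closed_vimage[OF F(1), unfolded vimage_def] continuous_intros)
  have B_iff: "(y, x) \<in> B \<longleftrightarrow> (\<exists>z. (y, x, z) \<in> F')" for y x by (force simp: F(2) F'_def)
  define a where "a = outer_measure_of P (fst ` F')"
  obtain E where E: "E \<in> sets P" "fst ` F' \<subseteq> E" "a = emeasure P E"
    using outer_measure_of_attain[of "fst ` F'" P] by (auto simp: a_def)
  \<comment> \<open>Subtracting a positive error gives a strictly smaller number only if
    \<open>a\<close> is nonzero; for \<open>a = 0\<close> the empty family suffices.\<close>
  have "\<exists>C. compact C \<and> a \<le> emeasure P {y. \<exists>w\<in>C. (y, w) \<in> F'} + ennreal (inverse (real (Suc n)))"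
    (is "\<exists>C. ?good n C") for n
  proof (cases "a = 0")
    case False
    then have "a - ennreal (inverse (real (Suc n))) < a"
      using emeasure_finite[of E] E(3) by (intro ennreal_between) (auto simp: zero_less_iff_neq_zero less_top[symmetric])
    from closed_projection_inner_compact[OF F' P this[unfolded a_def]]
    show ?thesis by (auto simp: a_def[symmetric] ennreal_minus_le_iff add.commute)
  qed (auto intro!: exI[of _ "{}"])
  then obtain C where "\<And>n. ?good n (C n)" using choice[of ?good] by blast
  then have C: "\<And>n. compact (C n)"
    "\<And>n. a \<le> emeasure P {y. \<exists>w\<in>C n. (y, w) \<in> F'} + ennreal (inverse (real (Suc n)))" by blast+
  define D where "D n = {y. \<exists>w\<in>C n. (y, w) \<in> F'}" for n
  have D_closed: "closed (D n)" for n
    unfolding D_def by (rule closed_projection_compact[OF F' C(1)])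
  then have D_meas: "D n \<in> sets P" for n by (simp add: P(2))
  have "a \<le> emeasure P (\<Union>n. D n)"
  proof (rule ennreal_le_epsilon)
    fix e :: real assume "0 < e"
    then obtain n where n: "inverse (real (Suc n)) < e" using reals_Archimedean by blast
    have "a \<le> emeasure P (D n) + ennreal (inverse (real (Suc n)))" using C(2) by (simp add: D_def)
    also have "\<dots> \<le> emeasure P (\<Union>n. D n) + ennreal e"
      using D_meas n by (intro add_mono emeasure_mono ennreal_leI) auto
    finally show "a \<le> emeasure P (\<Union>n. D n) + ennreal e" .
  qed
  moreover have "(\<Union>n. D n) \<subseteq> E" using E(2) by (force simp: D_def)
  ultimately have "emeasure P (E - (\<Union>n. D n)) = 0"
    using D_meas E by (subst emeasure_Diff) (auto simp: diff_eq_0_iff_ennreal less_top[symmetric])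
  then have AE: "AE y in P. y \<notin> E - (\<Union>n. D n)"
    using E(1) D_meas by (intro AE_not_in) (auto simp: null_sets_def)
  have "\<exists>s\<in>borel_measurable borel. \<forall>y\<in>D n. (y, s y) \<in> F'" for n
    using compact_section_selector[OF F' C(1)[of n]] by (auto simp: D_def)
  then obtain s where s: "\<And>n. s n \<in> borel_measurable borel" "\<And>n y. y \<in> D n \<Longrightarrow> (y, s n y) \<in> F'"
    by metis
  \<comment> \<open>The first \<open>n\<close> with \<open>y\<close> in \<open>D n\<close> decides
    which selector is used; points of the projection outside every \<open>D n\<close> form part of
    the exceptional null set.\<close>
  define T where "T y = fst (s (LEAST n. y \<in> D n) y)" for y
  have "T \<in> borel_measurable borel"
    unfolding T_def
  proof (rule measurable_compose_countable[where f = "\<lambda>n y. fst (s n y)"])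
    show "(\<lambda>y. fst (s n y)) \<in> borel_measurable borel" for n
      by (rule measurable_compose[OF s(1)]) (intro borel_measurable_continuous_onI continuous_intros)
    have "Measurable.pred borel (\<lambda>y. y \<in> D n)" for n using D_closed by (simp add: pred_def)
    then show "(\<lambda>y. LEAST n. y \<in> D n) \<in> borel \<rightarrow>\<^sub>M count_space UNIV" by (rule measurable_Least)
  qed
  moreover have "AE y in P. (\<exists>x. (y, x) \<in> B) \<longrightarrow> (y, T y) \<in> B"
    using AE
  proof eventually_elim
    case (elim y)
    show ?case
    proof
      assume "\<exists>x. (y, x) \<in> B"
      then have "y \<in> E" using E(2) by (force simp: B_iff)
      with elim have "\<exists>n. y \<in> D n" by auto
      then have "y \<in> D (LEAST n. y \<in> D n)" by (rule LeastI_ex)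
      from s(2)[OF this] show "(y, T y) \<in> B"
        unfolding B_iff T_def by (intro exI[of _ "snd (s (LEAST n. y \<in> D n) y)"]) simp
    qed
  qed
  ultimately show ?thesis by blast
qed

section \<open>Stochastic dominance\<close>

text \<open>This is the layer-cake formula: \<open>u x\<close> is the length of the set of levels
  \<open>t\<close> with \<open>0 < t \<le> u x\<close>, also when it is infinite, and Tonelli's
  theorem swaps the integrals.\<close>

lemma nn_integral_eq_integral_tail:
  fixes u :: "'a \<Rightarrow> ennreal"
  assumes "sigma_finite_measure M" and [measurable]: "u \<in> borel_measurable M"
  shows "(\<integral>\<^sup>+x. u x \<partial>M) =
    (\<integral>\<^sup>+t. indicator {0<..} t * emeasure M {x \<in> space M. ennreal t \<le> u x} \<partial>lborel)"
proof -
  interpret M: sigma_finite_measure M by fact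
  interpret pair_sigma_finite M lborel ..
  have ioc: "emeasure lborel {t. 0 < t \<and> ennreal t \<le> a} = a" for a
  proof (cases a)
    case (real r)
    then have "{t. 0 < t \<and> ennreal t \<le> a} = {0<..r}" by auto
    with real show ?thesis by simp
  next
    case top
    have "of_nat n \<le> emeasure lborel {t. 0 < t \<and> ennreal t \<le> a}" for n
    proof -
      have "of_nat n = emeasure lborel {0<..real n}" by (simp add: ennreal_of_nat_eq_real_of_nat)
      also have "\<dots> \<le> emeasure lborel {t. 0 < t \<and> ennreal t \<le> a}"
        using top by (intro emeasure_mono) auto
      finally show ?thesis .
    qed
    then have "emeasure lborel {t. 0 < t \<and> ennreal t \<le> a} = top"
      by (metis ennreal_Ex_less_of_nat leD top.not_eq_extremum)
    with top show ?thesis by simp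
  qed
  have "(\<integral>\<^sup>+x. u x \<partial>M) = (\<integral>\<^sup>+x. (\<integral>\<^sup>+t. indicator {t. 0 < t \<and> ennreal t \<le> u x} t \<partial>lborel) \<partial>M)"
    by (subst nn_integral_indicator) (auto simp: ioc)
  also have "\<dots> = (\<integral>\<^sup>+x. (\<integral>\<^sup>+t. indicator {0<..} t * indicator {x \<in> space M. ennreal t \<le> u x} x \<partial>lborel) \<partial>M)"
    by (intro nn_integral_cong) (auto split: split_indicator)
  also have "\<dots> = (\<integral>\<^sup>+t. (\<integral>\<^sup>+x. indicator {0<..} t * indicator {x \<in> space M. ennreal t \<le> u x} x \<partial>M) \<partial>lborel)"
    by (rule Fubini'[symmetric]) simp
  also have "\<dots> = (\<integral>\<^sup>+t. indicator {0<..} t * emeasure M {x \<in> space M. ennreal t \<le> u x} \<partial>lborel)"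
    by (intro nn_integral_cong) (simp add: nn_integral_cmult)
  finally show ?thesis .
qed

lemma nn_integral_mono_tail:
  fixes u :: "'a \<Rightarrow> ennreal" and v :: "'b \<Rightarrow> ennreal"
  assumes "sigma_finite_measure M" "u \<in> borel_measurable M"
    and "sigma_finite_measure N" "v \<in> borel_measurable N"
    and "\<And>t. 0 < t \<Longrightarrow> emeasure M {x \<in> space M. ennreal t \<le> u x} \<le> emeasure N {x \<in> space N. ennreal t \<le> v x}"
  shows "(\<integral>\<^sup>+x. u x \<partial>M) \<le> (\<integral>\<^sup>+x. v x \<partial>N)"
  unfolding nn_integral_eq_integral_tail[OF assms(1,2)] nn_integral_eq_integral_tail[OF assms(3,4)]
  by (intro nn_integral_mono) (auto split: split_indicator intro: assms(5))

lemma ennreal_le_e2ennreal_iff: "0 < t \<Longrightarrow> ennreal t \<le> e2ennreal x \<longleftrightarrow> ereal t \<le> x"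
  by (cases x) (auto simp: ennreal_le_iff2 ennreal.abs_eq[symmetric] e2ennreal_neg)

text \<open>Weak upper tails control the positive parts. The tails of the negative parts are
  complements of strict upper tails, and since both measures have mass 1 the inequality is
  reversed.\<close>

lemma ereal_expectation_mono_tail:
  fixes f :: "'a \<Rightarrow> ereal" and g :: "'b \<Rightarrow> ereal"
  assumes "prob_space Q" "prob_space P"
    and [measurable]: "f \<in> borel_measurable Q" "g \<in> borel_measurable P"
    and le: "\<And>s. emeasure Q {x \<in> space Q. ereal s \<le> f x} \<le> emeasure P {x \<in> space P. ereal s \<le> g x}"
    and less: "\<And>s. emeasure Q {x \<in> space Q. ereal s < f x} \<le> emeasure P {x \<in> space P. ereal s < g x}"
  shows "ereal_expectation Q f \<le> ereal_expectation P g"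
proof -
  interpret P: prob_space P by fact
  interpret Q: prob_space Q by fact
  have "(\<integral>\<^sup>+x. e2ennreal (f x) \<partial>Q) \<le> (\<integral>\<^sup>+x. e2ennreal (g x) \<partial>P)"
    by (intro nn_integral_mono_tail P.sigma_finite_measure_axioms Q.sigma_finite_measure_axioms)
       (simp_all add: ennreal_le_e2ennreal_iff le)
  moreover have "(\<integral>\<^sup>+x. e2ennreal (- g x) \<partial>P) \<le> (\<integral>\<^sup>+x. e2ennreal (- f x) \<partial>Q)"
  proof (intro nn_integral_mono_tail P.sigma_finite_measure_axioms Q.sigma_finite_measure_axioms)
    fix t :: real assume "0 < t"
    have *: "{x \<in> A. ennreal t \<le> e2ennreal (- k x)} = A - {x \<in> A. ereal (- t) < k x}" for A and k :: "'c \<Rightarrow> ereal"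
    proof -
      have "ereal t \<le> - z \<longleftrightarrow> \<not> ereal (- t) < z" for z by (cases z) auto
      then show ?thesis using \<open>0 < t\<close> by (auto simp: ennreal_le_e2ennreal_iff)
    qed
    show "emeasure P {x \<in> space P. ennreal t \<le> e2ennreal (- g x)} \<le> emeasure Q {x \<in> space Q. ennreal t \<le> e2ennreal (- f x)}"
      unfolding * using less[of "- t"]
      by (subst (1 2) emeasure_compl) (auto simp: P.emeasure_space_1 Q.emeasure_space_1 intro: ennreal_minus_mono)
  qed simp_all
  ultimately show ?thesis
    unfolding ereal_expectation_def by (intro ereal_minus_mono) (simp_all add: less_eq_ennreal.rep_eq[symmetric])
qed

section \<open>Transport cost and the measure of enlarged sets\<close>

lemma closed_sublevel:
  fixes c :: "'a::topological_space \<Rightarrow> 'b::topological_space \<Rightarrow> real"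
  assumes "continuous_on UNIV (\<lambda>(y, x). c y x)"
  shows "closed {p. c (fst p) (snd p) \<le> r}"
  using assms by (intro closed_Collect_le) (auto simp: case_prod_beta)

text \<open>The set of points within cost \<open>\<rho>\<close> of a Borel set \<open>A\<close> need
  not be Borel, so a Borel set \<open>D\<close> that contains it up to a \<open>P\<close>-null set
  stands in for it. For compact \<open>K\<close> these sets are closed, and inner regularity of
  \<open>Q\<close> passes from \<open>K\<close> to \<open>A\<close>.\<close>

lemma max_transport_cost_le_imp_measure_le:
  fixes P Q :: "'a::polish_space measure"
  assumes P: "P \<in> space (prob_algebra borel)" and Q: "Q \<in> space (prob_algebra borel)"
    and c: "continuous_on UNIV (\<lambda>(y, x). c y x)"
    and cost: "max_transport_cost c P Q \<le> ereal \<rho>"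
    and A: "A \<in> sets borel" and D: "D \<in> sets borel"
    and AD: "AE y in P. (\<exists>x\<in>A. c y x \<le> \<rho>) \<longrightarrow> y \<in> D"
  shows "emeasure Q A \<le> emeasure P D"
proof -
  have sP: "sets P = sets borel" "prob_space P" and sQ: "sets Q = sets borel" "prob_space Q"
    using P Q by (auto simp: space_prob_algebra)
  interpret P: prob_space P by fact
  interpret Q: prob_space Q by fact
  have "emeasure Q K \<le> emeasure P D" if K: "K \<subseteq> A" "compact K" for K
  proof -
    define N where "N r = {y. \<exists>x\<in>K. c y x \<le> r}" for r
    have N_mono: "N r \<subseteq> N r'" if "r \<le> r'" for r r'
      using that unfolding N_def by (blast intro: order_trans)
    have "closed (N r)" for r
      using closed_projection_compact[OF closed_sublevel[OF c] K(2), of r] by (simp add: N_def)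
    then have N: "N r \<in> sets borel" for r by (rule borel_closed)
    have "K \<in> sets borel" using K(2) by (intro borel_closed compact_imp_closed)
    \<comment> \<open>The bound on the infimum provides a coupling only for each strictly larger
      radius, and that coupling may change with \<open>n\<close>.\<close>
    have "emeasure Q K \<le> emeasure P (N (\<rho> + inverse (real (Suc n))))" for n
    proof -
      let ?r = "\<rho> + inverse (real (Suc n))"
      have "ereal \<rho> < ereal ?r" by simp
      with cost have "max_transport_cost c P Q < ereal ?r" by (rule le_less_trans)
      then obtain \<gamma> where \<gamma>: "\<gamma> \<in> couplings P Q" "esssup \<gamma> (\<lambda>(y, x). ereal (c y x)) < ereal ?r"
        unfolding max_transport_cost_def INF_less_iff by blast
      have s\<gamma>: "sets \<gamma> = sets borel" and margs: "distr \<gamma> borel fst = P" "distr \<gamma> borel snd = Q"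
        using \<gamma>(1) by (auto simp: couplings_def space_prob_algebra)
      have m: "fst \<in> borel_measurable \<gamma>" "snd \<in> borel_measurable \<gamma>"
        unfolding measurable_cong_sets[OF s\<gamma> refl]
        by (intro borel_measurable_continuous_onI continuous_intros)+
      let ?e = "esssup \<gamma> (\<lambda>p. ereal (c (fst p) (snd p)))"
      have "?e < ereal ?r" using \<gamma>(2) unfolding case_prod_unfold .
      moreover have "AE p in \<gamma>. ereal (c (fst p) (snd p)) \<le> ?e" by (rule esssup_AE)
      ultimately have AE: "AE p in \<gamma>. c (fst p) (snd p) \<le> ?r"
        by (auto elim!: eventually_mono dest: le_less_trans)
      have "emeasure Q K = emeasure \<gamma> (snd -` K \<inter> space \<gamma>)"
        unfolding margs(2)[symmetric] using m(2) \<open>K \<in> sets borel\<close> by (rule emeasure_distr)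
      also have "\<dots> \<le> emeasure \<gamma> (fst -` N ?r \<inter> space \<gamma>)"
      proof (rule emeasure_mono_AE)
        show "AE p in \<gamma>. p \<in> snd -` K \<inter> space \<gamma> \<longrightarrow> p \<in> fst -` N ?r \<inter> space \<gamma>"
          using AE by eventually_elim (auto simp: N_def)
        show "fst -` N ?r \<inter> space \<gamma> \<in> sets \<gamma>" using m(1) N by (rule measurable_sets)
      qed
      also have "\<dots> = emeasure P (N ?r)"
        unfolding margs(1)[symmetric] using m(1) N by (rule emeasure_distr[symmetric])
      finally show ?thesis .
    qed
    then have "emeasure Q K \<le> (INF n. emeasure P (N (\<rho> + inverse (real (Suc n)))))"
      by (rule INF_greatest)
    also have "\<dots> = emeasure P (\<Inter>n. N (\<rho> + inverse (real (Suc n))))"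
    proof (rule INF_emeasure_decseq)
      show "decseq (\<lambda>n. N (\<rho> + inverse (real (Suc n))))"
      proof (rule decseq_SucI)
        fix n
        have "inverse (real (Suc (Suc n))) \<le> inverse (real (Suc n))" by (rule le_imp_inverse_le) auto
        then show "N (\<rho> + inverse (real (Suc (Suc n)))) \<subseteq> N (\<rho> + inverse (real (Suc n)))"
          by (intro N_mono) simp
      qed
    qed (use N sP in auto)
    also have "\<dots> \<le> emeasure P D"
    proof (rule emeasure_mono_AE)
      \<comment> \<open>The witness for radius \<open>\<rho> + 1 / (n + 1)\<close> depends on
        \<open>n\<close>; a minimiser of \<open>c y\<close> over \<open>K\<close> serves for all
        \<open>n\<close> simultaneously.\<close>
      have "\<exists>x\<in>A. c y x \<le> \<rho>" if y: "\<And>n. y \<in> N (\<rho> + inverse (real (Suc n)))" for y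
      proof -
        have "K \<noteq> {}" using y[of 0] by (auto simp: N_def)
        moreover have "continuous_on K (c y)"
          using continuous_on_compose2[OF c, of K "\<lambda>x. (y, x)"] by (simp add: continuous_intros)
        ultimately obtain x where x: "x \<in> K" "\<And>x'. x' \<in> K \<Longrightarrow> c y x \<le> c y x'"
          using continuous_attains_inf[OF K(2)] by metis
        have "c y x \<le> \<rho>"
        proof (rule field_le_epsilon)
          fix e :: real assume "0 < e"
          then obtain n where "inverse (real (Suc n)) < e" using reals_Archimedean by blast
          moreover obtain x' where "x' \<in> K" "c y x' \<le> \<rho> + inverse (real (Suc n))"
            using y[of n] by (auto simp: N_def)
          ultimately show "c y x \<le> \<rho> + e" using x(2)[of x'] by linarith
        qed
        with x(1) K(1) show ?thesis by blast
      qed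
      then show "AE y in P. y \<in> (\<Inter>n. N (\<rho> + inverse (real (Suc n)))) \<longrightarrow> y \<in> D"
        using AD by (auto elim!: eventually_mono)
    qed (simp add: D sP)
    finally show ?thesis .
  qed
  then show ?thesis
    using A by (subst inner_regular[OF sQ(1)]) (auto intro: SUP_least)
qed

section \<open>The robust loss\<close>

text \<open>Selectors for the countably many conditions "\<open>f\<close> exceeds a rational level
  within cost \<open>\<rho>\<close>" are combined into running maxima. They start at the identity,
  which has cost 0, so that \<open>f\<close> along them stays above \<open>f\<close> itself.\<close>

lemma sup_over_sublevel_selectors:
  fixes P :: "'a::polish_space measure"
    and c :: "'a \<Rightarrow> 'a \<Rightarrow> real"
  assumes P: "P \<in> space (prob_algebra borel)"
    and c: "continuous_on UNIV (\<lambda>(y, x). c y x)" "\<And>x. c x x = 0" "0 \<le> \<rho>"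
    and f [measurable]: "f \<in> borel_measurable borel"
  obtains T :: "nat \<Rightarrow> 'a \<Rightarrow> 'a"
  where "\<And>n. T n \<in> borel_measurable borel" "\<And>n y. c y (T n y) \<le> \<rho>" "\<And>y. T 0 y = y"
    "\<And>y. incseq (\<lambda>n. f (T n y))"
    "AE y in P. (SUP x\<in>{x. c y x \<le> \<rho>}. ereal (f x)) = (SUP n. ereal (f (T n y)))"
proof -
  have sP: "sets P = sets borel" "prob_space P" using P by (auto simp: space_prob_algebra)
  interpret P: prob_space P by fact
  have c_meas: "(\<lambda>y. c (g y) (h y)) \<in> borel_measurable borel"
    if [measurable]: "g \<in> borel_measurable borel" "h \<in> borel_measurable borel" for g h :: "'a \<Rightarrow> 'a"
    by (rule borel_measurable_continuous_Pair[OF that])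
       (use c(1) in \<open>simp add: case_prod_unfold\<close>)
  define B where "B n = {p. c (fst p) (snd p) \<le> \<rho> \<and> real_of_rat (from_nat n) < f (snd p)}" for n :: nat
  have B: "B n \<in> sets borel" for n
  proof -
    have "(snd :: 'a \<times> 'a \<Rightarrow> 'a) \<in> borel_measurable borel"
      by (intro borel_measurable_continuous_onI continuous_intros)
    then have "{p :: 'a \<times> 'a. real_of_rat (from_nat n) < f (snd p)} \<in> sets borel" by measurable
    moreover have "{p. c (fst p) (snd p) \<le> \<rho>} \<in> sets borel"
      by (intro borel_closed closed_sublevel[OF c(1)])
    ultimately show ?thesis unfolding B_def Collect_conj_eq by (rule sets.Int[rotated])
  qed
  have "\<forall>n. \<exists>T. T \<in> borel_measurable borel \<and> (AE y in P. (\<exists>x. (y, x) \<in> B n) \<longrightarrow> (y, T y) \<in> B n)"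
    (is "\<forall>n. \<exists>T. ?sel n T")
    using measurable_selection_AE[OF P.finite_measure_axioms sP(1) B] by blast
  then have "\<exists>S. \<forall>n. ?sel n (S n)" by (rule choice)
  then obtain S where S [measurable]: "\<And>n. S n \<in> borel_measurable borel"
    and S_AE: "\<And>n. AE y in P. (\<exists>x. (y, x) \<in> B n) \<longrightarrow> (y, S n y) \<in> B n" by blast
  \<comment> \<open>\<open>S n\<close> is reliable only almost everywhere, so admissibility is
    tested pointwise and the old value kept on failure; this makes the cost bound and the
    monotonicity hold everywhere.\<close>
  define T where "T = rec_nat (\<lambda>y. y) (\<lambda>n t y. if c y (S n y) \<le> \<rho> \<and> f (t y) < f (S n y) then S n y else t y)"
  have T_simps: "T 0 = (\<lambda>y. y)"
    "T (Suc n) = (\<lambda>y. if c y (S n y) \<le> \<rho> \<and> f (T n y) < f (S n y) then S n y else T n y)" for n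
    unfolding T_def by simp_all
  have T_meas: "T n \<in> borel_measurable borel" for n
  proof (induction n)
    case (Suc n)
    note [measurable] = Suc c_meas
    show ?case unfolding T_simps by measurable
  qed (simp add: T_simps)
  have T_c: "c y (T n y) \<le> \<rho>" for n y by (induction n) (auto simp: T_simps c)
  have T_inc: "incseq (\<lambda>n. f (T n y))" for y by (rule incseq_SucI) (auto simp: T_simps)
  have "AE y in P. \<forall>n. (\<exists>x. (y, x) \<in> B n) \<longrightarrow> (y, S n y) \<in> B n"
    using S_AE by (simp add: AE_all_countable)
  then have "AE y in P. (SUP x\<in>{x. c y x \<le> \<rho>}. ereal (f x)) = (SUP n. ereal (f (T n y)))"
  proof (rule eventually_mono)
    fix y assume y: "\<forall>n. (\<exists>x. (y, x) \<in> B n) \<longrightarrow> (y, S n y) \<in> B n"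
    show "(SUP x\<in>{x. c y x \<le> \<rho>}. ereal (f x)) = (SUP n. ereal (f (T n y)))"
    proof (intro antisym SUP_least)
      show "ereal (f (T n y)) \<le> (SUP x\<in>{x. c y x \<le> \<rho>}. ereal (f x))" for n
        by (intro SUP_upper) (simp add: T_c)
      fix x assume x: "x \<in> {x. c y x \<le> \<rho>}"
      show "ereal (f x) \<le> (SUP n. ereal (f (T n y)))"
      proof (rule ccontr)
        assume "\<not> ?thesis"
        \<comment> \<open>A rational level between the supposed supremum and \<open>f x\<close> puts
          \<open>(y, x)\<close> into some \<open>B n\<close>, so \<open>S n y\<close>, and hence
          \<open>T (Suc n) y\<close>, exceeds that supremum.\<close>
        then obtain r where r: "(SUP n. ereal (f (T n y))) < ereal r" "r < f x"
          using ereal_dense2[of "SUP n. ereal (f (T n y))" "ereal (f x)"] by (auto simp: not_le)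
        obtain q where q: "r < real_of_rat q" "real_of_rat q < f x" using of_rat_dense[OF r(2)] by blast
        obtain n where n: "q = from_nat n" by (metis from_nat_to_nat)
        from x q n have "(y, x) \<in> B n" by (simp add: B_def)
        with y have "(y, S n y) \<in> B n" by blast
        then have "r < f (T (Suc n) y)" using q n by (auto simp: B_def T_simps)
        then have "ereal r < ereal (f (T (Suc n) y))" by simp
        also have "\<dots> \<le> (SUP n. ereal (f (T n y)))" by (intro SUP_upper) simp
        finally show False using r(1) by simp
      qed
    qed
  qed
  with T_meas T_c T_inc show thesis by (intro that[of T]) (auto simp: T_simps)
qed

text \<open>Positive parts increase and negative parts decrease; monotone convergence applies to
  each, for the latter because the first integral is finite.\<close>

lemma ereal_expectation_SUP_tendsto:
  fixes f :: "nat \<Rightarrow> 'a \<Rightarrow> ereal"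
  assumes [measurable]: "\<And>n. f n \<in> borel_measurable M"
    and inc: "\<And>x. incseq (\<lambda>n. f n x)"
    and neg: "(\<integral>\<^sup>+x. e2ennreal (- f 0 x) \<partial>M) < \<infinity>"
  shows "(\<lambda>n. ereal_expectation M (f n)) \<longlonglongrightarrow> ereal_expectation M (\<lambda>x. SUP n. f n x)"
proof -
  have lim: "(\<lambda>n. f n x) \<longlonglongrightarrow> (SUP n. f n x)" for x by (rule LIMSEQ_SUP[OF inc])
  have tends: "(\<lambda>n. e2ennreal (u n)) \<longlonglongrightarrow> e2ennreal l" if "u \<longlonglongrightarrow> l" for u :: "nat \<Rightarrow> ereal" and l
    by (rule continuous_on_tendsto_compose[OF continuous_on_e2ennreal[of UNIV] that]) auto
  have inc_pos: "incseq (\<lambda>n x. e2ennreal (f n x))"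
    using inc by (auto simp: incseq_def le_fun_def intro: e2ennreal_mono)
  have dec_x: "decseq (\<lambda>n. e2ennreal (- f n x))" for x
    by (intro decseq_SucI e2ennreal_mono) (simp add: incseq_SucD[OF inc])
  have dec_neg: "decseq (\<lambda>n x. e2ennreal (- f n x))"
    by (intro decseq_SucI le_funI decseq_SucD[OF dec_x])
  have pos: "(SUP n. e2ennreal (f n x)) = e2ennreal (SUP n. f n x)" for x
    using inc_pos by (intro LIMSEQ_unique[OF LIMSEQ_SUP tends[OF lim]]) (auto simp: incseq_def le_fun_def)
  have neg_eq: "(INF n. e2ennreal (- f n x)) = e2ennreal (- (SUP n. f n x))" for x
    by (rule LIMSEQ_unique[OF LIMSEQ_INF[OF dec_x] tends[OF tendsto_uminus_ereal[OF lim]]])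
  have "(\<lambda>n. \<integral>\<^sup>+x. e2ennreal (f n x) \<partial>M) \<longlonglongrightarrow> (SUP n. \<integral>\<^sup>+x. e2ennreal (f n x) \<partial>M)"
    using inc_pos by (intro LIMSEQ_SUP) (auto simp: incseq_def le_fun_def intro!: nn_integral_mono)
  also have "(SUP n. \<integral>\<^sup>+x. e2ennreal (f n x) \<partial>M) = (\<integral>\<^sup>+x. e2ennreal (SUP n. f n x) \<partial>M)"
    unfolding pos[symmetric] by (intro nn_integral_monotone_convergence_SUP[symmetric] inc_pos) simp
  finally have lim_pos: "(\<lambda>n. \<integral>\<^sup>+x. e2ennreal (f n x) \<partial>M) \<longlonglongrightarrow> (\<integral>\<^sup>+x. e2ennreal (SUP n. f n x) \<partial>M)" .
  have "(\<lambda>n. \<integral>\<^sup>+x. e2ennreal (- f n x) \<partial>M) \<longlonglongrightarrow> (INF n. \<integral>\<^sup>+x. e2ennreal (- f n x) \<partial>M)"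
    by (intro LIMSEQ_INF decseq_SucI nn_integral_mono decseq_SucD[OF dec_x])
  also have "(INF n. \<integral>\<^sup>+x. e2ennreal (- f n x) \<partial>M) = (\<integral>\<^sup>+x. e2ennreal (- (SUP n. f n x)) \<partial>M)"
    unfolding neg_eq[symmetric]
    by (intro nn_integral_monotone_convergence_INF_decseq[OF dec_neg _ neg, symmetric]) simp
  finally have lim_neg: "(\<lambda>n. \<integral>\<^sup>+x. e2ennreal (- f n x) \<partial>M) \<longlonglongrightarrow> (\<integral>\<^sup>+x. e2ennreal (- (SUP n. f n x)) \<partial>M)" .
  \<comment> \<open>A finite limit of the negative integrals excludes the difference of two
    infinities.\<close>
  have "(\<integral>\<^sup>+x. e2ennreal (- (SUP n. f n x)) \<partial>M) \<le> (\<integral>\<^sup>+x. e2ennreal (- f 0 x) \<partial>M)"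
    by (intro nn_integral_mono e2ennreal_mono) (auto intro: SUP_upper)
  with neg have "enn2ereal (\<integral>\<^sup>+x. e2ennreal (- (SUP n. f n x)) \<partial>M) \<noteq> \<infinity>"
    by (cases "\<integral>\<^sup>+x. e2ennreal (- (SUP n. f n x)) \<partial>M") (auto simp: enn2ereal_ennreal)
  moreover have "enn2ereal z \<noteq> - \<infinity>" for z by (metis enn2ereal_nonneg ereal_less_eq(2) infinity_ereal_def not_MInfty_nonneg)
  ultimately show ?thesis
    unfolding ereal_expectation_def
    by (intro tendsto_diff_ereal_general tendsto_enn2erealI lim_pos lim_neg) auto
qed

text \<open>The image of \<open>P\<close> under \<open>T\<close> is feasible:
  \<open>y \<mapsto> (y, T y)\<close> pushes \<open>P\<close> to a coupling whose cost is bounded by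
  \<open>\<rho>\<close>. The bound on the negative part makes its expectation well defined, as
  membership in the supremum requires.\<close>

lemma expectation_selector_le_robust_loss:
  fixes P :: "'a::polish_space measure"
    and c :: "'a \<Rightarrow> 'a \<Rightarrow> real"
  assumes P: "P \<in> space (prob_algebra borel)"
    and c: "continuous_on UNIV (\<lambda>(y, x). c y x)"
    and f [measurable]: "f \<in> borel_measurable borel"
    and T [measurable]: "T \<in> borel_measurable borel" and cT: "\<And>y. c y (T y) \<le> \<rho>"
    and neg: "(\<integral>\<^sup>+y. e2ennreal (- ereal (f (T y))) \<partial>P) < \<infinity>"
  shows "ereal_expectation P (\<lambda>y. ereal (f (T y))) \<le> robust_loss c P f \<rho>"
proof -
  have sP [measurable_cong]: "sets P = sets borel" and "prob_space P" using P by (auto simp: space_prob_algebra)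
  interpret P: prob_space P by fact
  let ?Q = "distr P borel T" and ?\<gamma> = "distr P borel (\<lambda>y. (y, T y))"
  have pair: "(\<lambda>y. (y, T y)) \<in> borel_measurable P"
    unfolding borel_prod[symmetric] by measurable
  have cm: "(\<lambda>(y, x). ereal (c y x)) \<in> borel_measurable borel"
    using c by (intro borel_measurable_continuous_onI) (auto simp: case_prod_unfold intro: continuous_on_ereal)
  have fst_m: "(fst :: 'a \<times> 'a \<Rightarrow> 'a) \<in> borel_measurable borel" and snd_m: "(snd :: 'a \<times> 'a \<Rightarrow> 'a) \<in> borel_measurable borel"
    by (intro borel_measurable_continuous_onI continuous_intros)+
  have "distr P borel (\<lambda>y. y) = P" using sP by (intro distr_id2) simp
  then have "?\<gamma> \<in> couplings P ?Q"
    unfolding couplings_def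
    by (auto simp: space_prob_algebra P.prob_space_distr pair distr_distr[OF fst_m pair] distr_distr[OF snd_m pair] comp_def)
  moreover have "esssup ?\<gamma> (\<lambda>(y, x). ereal (c y x)) \<le> ereal \<rho>"
  proof (rule esssup_I)
    show "(\<lambda>(y, x). ereal (c y x)) \<in> borel_measurable ?\<gamma>" using cm by simp
    have "{p. (case p of (y, x) \<Rightarrow> ereal (c y x)) \<le> ereal \<rho>} \<in> sets borel"
      using cm by measurable
    then show "AE p in ?\<gamma>. (case p of (y, x) \<Rightarrow> ereal (c y x)) \<le> ereal \<rho>"
      by (subst AE_distr_iff[OF pair]) (auto simp: cT)
  qed
  ultimately have "max_transport_cost c P ?Q \<le> ereal \<rho>"
    unfolding max_transport_cost_def by (rule INF_lower2)
  moreover have "?Q \<in> space (prob_algebra borel)"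
    by (auto simp: space_prob_algebra intro!: P.prob_space_distr)
  moreover have "(\<integral>\<^sup>+x. e2ennreal (- ereal (f x)) \<partial>?Q) = (\<integral>\<^sup>+y. e2ennreal (- ereal (f (T y))) \<partial>P)"
    "(\<integral>\<^sup>+x. e2ennreal (ereal (f x)) \<partial>?Q) = (\<integral>\<^sup>+y. e2ennreal (ereal (f (T y))) \<partial>P)"
    by (subst nn_integral_distr; simp)+
  ultimately show ?thesis
    unfolding robust_loss_def using neg
    by (intro Sup_upper CollectI exI[of _ ?Q]) (auto simp: ereal_expectation_def ereal_expectation_exists_def)
qed

text \<open>The pointwise supremum equals a Borel function \<open>g\<close> almost everywhere, which
  settles its measurability for the completion. Selectors give one inequality with \<open>g\<close>,
  comparison of tails the other.\<close>

lemma robust_loss_eq_expectation_sup: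
  fixes P :: "'a::polish_space measure"
    and c :: "'a \<Rightarrow> 'a \<Rightarrow> real"
  assumes P: "P \<in> space (prob_algebra borel)"
    and c: "continuous_on UNIV (\<lambda>(y, x). c y x)" "\<And>x. c x x = 0"
    and f [measurable]: "f \<in> borel_measurable borel"
    and ex: "ereal_expectation_exists P (\<lambda>x. ereal (f x))"
    and gt: "ereal_expectation P (\<lambda>x. ereal (f x)) > - \<infinity>"
    and \<rho>: "0 \<le> \<rho>"
  shows "ereal_expectation_exists (completion P) (\<lambda>y. SUP x\<in>{x. c y x \<le> \<rho>}. ereal (f x))"
    and "robust_loss c P f \<rho> = ereal_expectation (completion P) (\<lambda>y. SUP x\<in>{x. c y x \<le> \<rho>}. ereal (f x))"
proof -
  have sP [measurable_cong]: "sets P = sets borel" and "prob_space P" using P by (auto simp: space_prob_algebra)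
  interpret P: prob_space P by fact
  let ?h = "\<lambda>y. SUP x\<in>{x. c y x \<le> \<rho>}. ereal (f x)"
  obtain T where T [measurable]: "\<And>n. T n \<in> borel_measurable borel"
    and cT: "\<And>n y. c y (T n y) \<le> \<rho>" and T0: "\<And>y. T 0 y = y"
    and inc: "\<And>y. incseq (\<lambda>n. f (T n y))"
    and AE: "AE y in P. ?h y = (SUP n. ereal (f (T n y)))"
    by (rule sup_over_sublevel_selectors[OF P c \<rho> f]) blast
  define g where "g y = (SUP n. ereal (f (T n y)))" for y
  have g [measurable]: "g \<in> borel_measurable P" unfolding g_def by measurable
  have AE: "AE y in P. ?h y = g y" using AE by (simp add: g_def)
  \<comment> \<open>If the negative part had infinite integral, existence of the expectation would
    make the positive one finite and the expectation \<open>- \<infinity>\<close>.\<close>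
  have neg: "(\<integral>\<^sup>+y. e2ennreal (- ereal (f y)) \<partial>P) < \<infinity>"
  proof (rule ccontr)
    assume "\<not> ?thesis"
    then have inf: "(\<integral>\<^sup>+y. e2ennreal (- ereal (f y)) \<partial>P) = \<infinity>" by (simp add: not_less top_unique)
    with ex have "(\<integral>\<^sup>+y. e2ennreal (ereal (f y)) \<partial>P) < \<infinity>" by (simp add: ereal_expectation_exists_def)
    with inf have "ereal_expectation P (\<lambda>x. ereal (f x)) = - \<infinity>"
      by (cases "\<integral>\<^sup>+y. e2ennreal (ereal (f y)) \<partial>P") (auto simp: ereal_expectation_def enn2ereal_ennreal)
    with gt show False by simp
  qed
  have f_le: "f y \<le> f (T n y)" for n y using incseqD[OF inc, of 0 n y] by (simp add: T0)
  have neg_T: "(\<integral>\<^sup>+y. e2ennreal (- ereal (f (T n y))) \<partial>P) < \<infinity>" for n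
    by (rule le_less_trans[OF _ neg]) (intro nn_integral_mono e2ennreal_mono, simp add: f_le)
  have f_le_g: "ereal (f y) \<le> g y" for y
    unfolding g_def by (rule SUP_upper2[of 0]) (simp_all add: T0)
  have neg_g: "(\<integral>\<^sup>+y. e2ennreal (- g y) \<partial>P) < \<infinity>"
    by (rule le_less_trans[OF _ neg]) (intro nn_integral_mono e2ennreal_mono, simp only: ereal_minus_le_minus f_le_g)
  have int_h: "(\<integral>\<^sup>+y. e2ennreal (?h y) \<partial>completion P) = (\<integral>\<^sup>+y. e2ennreal (g y) \<partial>P)"
    "(\<integral>\<^sup>+y. e2ennreal (- ?h y) \<partial>completion P) = (\<integral>\<^sup>+y. e2ennreal (- g y) \<partial>P)"
    unfolding nn_integral_completion by (intro nn_integral_cong_AE; use AE in eventually_elim; simp)+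
  have h_meas: "?h \<in> borel_measurable (completion P)"
  proof (rule measurableI)
    fix A :: "ereal set" assume A: "A \<in> sets borel"
    show "?h -` A \<inter> space (completion P) \<in> sets (completion P)"
    proof (rule completion.in_sets_AE)
      show "g -` A \<inter> space P \<in> sets (completion P)"
        using measurable_sets[OF g A] by simp
      show "AE y in completion P. y \<in> g -` A \<inter> space P \<longleftrightarrow> y \<in> ?h -` A \<inter> space (completion P)"
        by (rule AE_completion, use AE in eventually_elim) simp
    qed auto
  qed simp
  show "ereal_expectation_exists (completion P) ?h"
    unfolding ereal_expectation_exists_def int_h using h_meas neg_g by simp
  have exp_h: "ereal_expectation (completion P) ?h = ereal_expectation P g"
    unfolding ereal_expectation_def int_h ..
  show "robust_loss c P f \<rho> = ereal_expectation (completion P) ?h"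
    unfolding exp_h
  proof (rule antisym)
    have "(\<lambda>n. ereal_expectation P (\<lambda>y. ereal (f (T n y)))) \<longlonglongrightarrow> ereal_expectation P g"
      unfolding g_def using inc neg_T[of 0]
      by (intro ereal_expectation_SUP_tendsto) (auto simp: incseq_def)
    then show "ereal_expectation P g \<le> robust_loss c P f \<rho>"
      by (rule LIMSEQ_le_const2) (auto intro!: exI expectation_selector_le_robust_loss[OF P c(1) f T cT neg_T])
    have "ereal_expectation Q (\<lambda>x. ereal (f x)) \<le> ereal_expectation P g"
      if Q: "Q \<in> space (prob_algebra borel)" and cost: "max_transport_cost c P Q \<le> ereal \<rho>" for Q
    proof -
      have sQ [measurable_cong]: "sets Q = sets borel" and pQ: "prob_space Q"
        using Q by (auto simp: space_prob_algebra)
      have spaces [simp]: "space P = UNIV" "space Q = UNIV"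
        using sets_eq_imp_space_eq[OF sP] sets_eq_imp_space_eq[OF sQ] by simp_all
      \<comment> \<open>Upward closed \<open>U\<close> treats closed and open half-lines together:
        if \<open>f x\<close> lies in \<open>U\<close> and \<open>x\<close> is within cost
        \<open>\<rho>\<close> of \<open>y\<close>, then the larger value \<open>g y\<close> lies in
        \<open>U\<close> for almost every such \<open>y\<close>.\<close>
      have le: "emeasure Q {x. ereal (f x) \<in> U} \<le> emeasure P {y. g y \<in> U}"
        if U [measurable]: "U \<in> sets borel" and up: "\<And>a b. a \<in> U \<Longrightarrow> a \<le> b \<Longrightarrow> b \<in> U" for U
      proof (rule max_transport_cost_le_imp_measure_le[OF P Q c(1) cost])
        show "{x. ereal (f x) \<in> U} \<in> sets borel" by measurable
        have "g -` U \<inter> space P \<in> sets P" by measurable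
        then show "{y. g y \<in> U} \<in> sets borel" by (simp add: sP vimage_def)
        show "AE y in P. (\<exists>x\<in>{x. ereal (f x) \<in> U}. c y x \<le> \<rho>) \<longrightarrow> y \<in> {y. g y \<in> U}"
          using AE
        proof eventually_elim
          case (elim y)
          show ?case
          proof
            assume "\<exists>x\<in>{x. ereal (f x) \<in> U}. c y x \<le> \<rho>"
            then obtain x where x: "ereal (f x) \<in> U" "c y x \<le> \<rho>" by blast
            have "ereal (f x) \<le> ?h y" using x(2) by (intro SUP_upper) simp
            with up[OF x(1)] elim show "y \<in> {y. g y \<in> U}" by simp
          qed
        qed
      qed
      show ?thesis
      proof (rule ereal_expectation_mono_tail[OF pQ P.prob_space_axioms])
        show "emeasure Q {x \<in> space Q. ereal s \<le> ereal (f x)} \<le> emeasure P {x \<in> space P. ereal s \<le> g x}" for s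
          using le[of "{ereal s..}"] by simp
        show "emeasure Q {x \<in> space Q. ereal s < ereal (f x)} \<le> emeasure P {x \<in> space P. ereal s < g x}" for s
          using le[of "{ereal s<..}"] by simp
      qed measurable
    qed
    then show "robust_loss c P f \<rho> \<le> ereal_expectation P g"
      unfolding robust_loss_def by (intro Sup_least) auto
  qed
qed

theorem theorem2:
  fixes P :: "'a::polish_space measure"
    and c :: "'a \<Rightarrow> 'a \<Rightarrow> real"
    and f :: "'a \<Rightarrow> real"
    and \<rho> lam :: real
  assumes "P \<in> space (prob_algebra borel)"
    and "continuous_on UNIV (\<lambda>(y, x). c y x)"
    and "\<And>y x. 0 \<le> c y x"
    and "\<And>x. c x x = 0"
    and "f \<in> borel_measurable borel"
    and "ereal_expectation_exists P (\<lambda>x. ereal (f x))"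
    and "ereal_expectation P (\<lambda>x. ereal (f x)) > - \<infinity>"
    and "0 \<le> \<rho>" and "0 \<le> lam"
  shows "ereal_expectation_exists (completion P) (\<lambda>y. SUP x\<in>{x. c y x \<le> \<rho>}. ereal (f x)) \<and>
    robust_loss c P f \<rho> =
      ereal_expectation (completion P) (\<lambda>y. SUP x\<in>{x. c y x \<le> \<rho>}. ereal (f x)) \<and>
    conjugate_nonneg (\<lambda>r. - robust_loss c P f r) (- lam) =
      (SUP r\<in>{0..}.
        ereal_expectation (completion P) (\<lambda>y. SUP x\<in>{x. c y x \<le> r}. ereal (f x)) - ereal (lam * r))"
proof (intro conjI)
  \<comment> \<open>The radius stays free, because the conjugate needs the identity at every
    \<open>r \<ge> 0\<close>.\<close>
  note main = robust_loss_eq_expectation_sup[OF assms(1,2,4,5,6,7)]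
  show "ereal_expectation_exists (completion P) (\<lambda>y. SUP x\<in>{x. c y x \<le> \<rho>}. ereal (f x))"
    by (rule main) fact
  show "robust_loss c P f \<rho> = ereal_expectation (completion P) (\<lambda>y. SUP x\<in>{x. c y x \<le> \<rho>}. ereal (f x))"
    by (rule main) fact
  show "conjugate_nonneg (\<lambda>r. - robust_loss c P f r) (- lam) =
      (SUP r\<in>{0..}.
        ereal_expectation (completion P) (\<lambda>y. SUP x\<in>{x. c y x \<le> r}. ereal (f x)) - ereal (lam * r))"
    unfolding conjugate_nonneg_uminus by (intro SUP_cong refl) (simp add: main(2))
qed

end
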